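(* For every integer $k>0$, the triple $(\mathcal P(k),r,\leq)$ is a topological Ramsey space. In fact, it is a closed subspace of $(\mathcal P,r,\leq)$.
   Context: For a set $x$, $x^{[<\infty]}$ is the set of finite subsets of $x$ and $x^{[\leq k]}$ is the set of subsets of $x$ with at most $k$ elements. Consider pairs $(x,S_x)$ with (i) $x\subseteq\mathbb N$; (ii) $S_x\subseteq x^{[<\infty]}$ hereditary ($u\subseteq v\in S_x$ implies $u\in S_x$); (iii) $\bigcup S_x=x$. $\mathcal{AP}$ (resp. $\mathcal P$) is the set of all such pairs with $x$ finite (resp. infinite); for $x=\emptyset$ the only pair considered is $(\emptyset,\{\emptyset\})$. $\mathcal P(k)$ (resp. $\mathcal{AP}(k)$) is the set of those $(x,S_x)$ in $\mathcal P$ (resp. $\mathcal{AP}$) with $S_x\subseteq x^{[\leq k]}$. Define $(y,S_y)\leq(x,S_x)$ iff $y\subseteq x$ and $S_y\subseteq S_x$. For $(A,S_A)\in\mathcal P$ and $n\in\mathbb N$, let $A\upharpoonright_n$ be the set of the first $n$ elements of $A$, and $r_n(A,S_A)=(A\upharpoonright_n,\{u\cap A\upharpoonright_n:u\in S_A\})$; $r$ is the map $((A,S_A),n)\mapsto r_n(A,S_A)$. On $\mathcal P(k)$ one uses the restrictions of $r$ and $\leq$. $\mathcal P$ is identified with a subspace of $\mathcal{AP}^{\mathbb N}$ (product of discrete spaces) via $(A,S_A)\mapsto(r_n(A,S_A))_n$; "closed subspace" refers to this topology. Topological Ramsey space: let $\mathcal R$ be $\mathcal P(k)$ and $\mathcal{AR}$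 the corresponding set of approximations $\mathcal{AP}(k)$. For $a\in\mathcal{AR}$, $A\in\mathcal R$ put $[a,A]=\{B\in\mathcal R:B\leq A\text{ and }r_n(B)=a\text{ for some }n\}$. A set $\mathcal X\subseteq\mathcal R$ is Ramsey if for every $[a,A]\neq\emptyset$ there is $B\in[a,A]$ with $[a,B]\subseteq\mathcal X$ or $[a,B]\cap\mathcal X=\emptyset$; it is Ramsey null if for every $[a,A]\neq\emptyset$ there is $B\in[a,A]$ with $[a,B]\cap\mathcal X=\emptyset$. $(\mathcal R,\leq,r)$ is a topological Ramsey space iff, with respect to the topology generated by the sets $[a,A]$, subsets of $\mathcal R$ with the Baire property are Ramsey and meager subsets of $\mathcal R$ are Ramsey null. *)

theory Defs
  imports "HOL-Analysis.Analysis"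
begin

section \<open>Category notions in a topological space\<close>

definition nowhere_dense_in :: "'a topology \<Rightarrow> 'a set \<Rightarrow> bool" where
  "nowhere_dense_in T N \<longleftrightarrow> N \<subseteq> topspace T \<and> T interior_of (T closure_of N) = {}"

definition meager_in :: "'a topology \<Rightarrow> 'a set \<Rightarrow> bool" where
  "meager_in T X \<longleftrightarrow> (\<exists>F. countable F \<and> (\<forall>N\<in>F. nowhere_dense_in T N) \<and> X = \<Union>F)"

definition Baire_property_in :: "'a topology \<Rightarrow> 'a set \<Rightarrow> bool" where
  "Baire_property_in T X \<longleftrightarrow>
     X \<subseteq> topspace T \<and> (\<exists>U. openin T U \<and> meager_in T ((X - U) \<union> (U - X)))"

section \<open>Topological Ramsey spaces\<close>

text \<open>Here \<open>R\<close> is the set of points, \<open>Apx\<close> the set of approximations, \<open>le\<close> the quasi-order and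
  \<open>r A n\<close> the \<open>n\<close>-th approximation of \<open>A\<close>. Only the values of \<open>le\<close> and \<open>r\<close> on \<open>R\<close> are used, so
  passing to a subset of \<open>R\<close> automatically restricts them.\<close>

definition Ramsey_nbhd ::
    "'a set \<Rightarrow> ('a \<Rightarrow> 'a \<Rightarrow> bool) \<Rightarrow> ('a \<Rightarrow> nat \<Rightarrow> 'b) \<Rightarrow> 'b \<Rightarrow> 'a \<Rightarrow> 'a set" where
  "Ramsey_nbhd R le r a A = {B \<in> R. le B A \<and> (\<exists>n. r B n = a)}"

definition Ramsey_topology ::
    "'a set \<Rightarrow> 'b set \<Rightarrow> ('a \<Rightarrow> 'a \<Rightarrow> bool) \<Rightarrow> ('a \<Rightarrow> nat \<Rightarrow> 'b) \<Rightarrow> 'a topology" where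
  "Ramsey_topology R Apx le r =
     topology_generated_by {Ramsey_nbhd R le r a A | a A. a \<in> Apx \<and> A \<in> R}"

definition is_Ramsey ::
    "'a set \<Rightarrow> 'b set \<Rightarrow> ('a \<Rightarrow> 'a \<Rightarrow> bool) \<Rightarrow> ('a \<Rightarrow> nat \<Rightarrow> 'b) \<Rightarrow> 'a set \<Rightarrow> bool" where
  "is_Ramsey R Apx le r X \<longleftrightarrow>
     (\<forall>a\<in>Apx. \<forall>A\<in>R. Ramsey_nbhd R le r a A \<noteq> {} \<longrightarrow>
        (\<exists>B \<in> Ramsey_nbhd R le r a A.
           Ramsey_nbhd R le r a B \<subseteq> X \<or> Ramsey_nbhd R le r a B \<inter> X = {}))"

definition is_Ramsey_null ::
    "'a set \<Rightarrow> 'b set \<Rightarrow> ('a \<Rightarrow> 'a \<Rightarrow> bool) \<Rightarrow> ('a \<Rightarrow> nat \<Rightarrow> 'b) \<Rightarrow> 'a set \<Rightarrow> bool" where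
  "is_Ramsey_null R Apx le r X \<longleftrightarrow>
     (\<forall>a\<in>Apx. \<forall>A\<in>R. Ramsey_nbhd R le r a A \<noteq> {} \<longrightarrow>
        (\<exists>B \<in> Ramsey_nbhd R le r a A. Ramsey_nbhd R le r a B \<inter> X = {}))"

definition topological_Ramsey_space ::
    "'a set \<Rightarrow> 'b set \<Rightarrow> ('a \<Rightarrow> 'a \<Rightarrow> bool) \<Rightarrow> ('a \<Rightarrow> nat \<Rightarrow> 'b) \<Rightarrow> bool" where
  "topological_Ramsey_space R Apx le r \<longleftrightarrow>
     (\<forall>X\<subseteq>R. Baire_property_in (Ramsey_topology R Apx le r) X \<longrightarrow> is_Ramsey R Apx le r X) \<and>
     (\<forall>X\<subseteq>R. meager_in (Ramsey_topology R Apx le r) X \<longrightarrow> is_Ramsey_null R Apx le r X)"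

text \<open>The topology on \<open>R\<close> obtained by identifying \<open>A\<close> with the sequence \<open>(r A n)\<^sub>n\<close> in the product
  of countably many copies of the discrete space \<open>Apx\<close>.\<close>

definition approx_topology :: "'a set \<Rightarrow> 'b set \<Rightarrow> ('a \<Rightarrow> nat \<Rightarrow> 'b) \<Rightarrow> 'a topology" where
  "approx_topology R Apx r =
     pullback_topology R (\<lambda>A n. r A n) (product_topology (\<lambda>_. discrete_topology Apx) UNIV)"

section \<open>Hereditary families on sets of natural numbers\<close>

type_synonym hfam = "nat set \<times> nat set set"

text \<open>The last conjunct excludes the pair \<open>({}, {})\<close>, which satisfies the other three.\<close>

definition hereditary_pair :: "hfam \<Rightarrow> bool" where
  "hereditary_pair = (\<lambda>(x, S).
     S \<subseteq> {u. u \<subseteq> x \<and> finite u} \<and>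
     (\<forall>u v. u \<subseteq> v \<and> v \<in> S \<longrightarrow> u \<in> S) \<and>
     \<Union>S = x \<and>
     (x = {} \<longrightarrow> S = {{}}))"

definition AP :: "hfam set" where
  "AP = {(x, S). hereditary_pair (x, S) \<and> finite x}"

definition P :: "hfam set" where
  "P = {(x, S). hereditary_pair (x, S) \<and> infinite x}"

definition AP_le :: "nat \<Rightarrow> hfam set" where
  "AP_le k = {(x, S) \<in> AP. S \<subseteq> {u. u \<subseteq> x \<and> finite u \<and> card u \<le> k}}"

definition P_le :: "nat \<Rightarrow> hfam set" where
  "P_le k = {(x, S) \<in> P. S \<subseteq> {u. u \<subseteq> x \<and> finite u \<and> card u \<le> k}}"

definition hfam_le :: "hfam \<Rightarrow> hfam \<Rightarrow> bool" where
  "hfam_le = (\<lambda>(y, Sy) (x, Sx). y \<subseteq> x \<and> Sy \<subseteq> Sx)"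

definition first_elems :: "nat set \<Rightarrow> nat \<Rightarrow> nat set" where
  "first_elems A n = enumerate A ` {..<n}"

definition restr :: "hfam \<Rightarrow> nat \<Rightarrow> hfam" where
  "restr = (\<lambda>(A, S) n. (first_elems A n, {u \<inter> first_elems A n | u. u \<in> S}))"

text \<open>The approximations of points lie in the intended sets, and on \<open>P\<close> the sequence of
  approximations determines the point, so that the identification above is legitimate.\<close>

lemma first_elems_subset: "infinite A \<Longrightarrow> first_elems A n \<subseteq> A"
  by (auto simp: first_elems_def enumerate_in_set)

lemma in_P_D:
  assumes "(A, S) \<in> P"
  shows "infinite A" "S \<subseteq> {u. u \<subseteq> A \<and> finite u}"
    "u \<subseteq> v \<Longrightarrow> v \<in> S \<Longrightarrow> u \<in> S" "\<Union>S = A"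
proof -
  have *: "infinite A \<and> S \<subseteq> {u. u \<subseteq> A \<and> finite u} \<and>
      (\<forall>u v. u \<subseteq> v \<and> v \<in> S \<longrightarrow> u \<in> S) \<and> \<Union>S = A"
    using assms by (simp add: P_def hereditary_pair_def)
  show "infinite A" "S \<subseteq> {u. u \<subseteq> A \<and> finite u}" "\<Union>S = A" using * by simp_all
  show "u \<in> S" if "u \<subseteq> v" "v \<in> S" using that * by meson
qed

lemma restr_in_AP:
  assumes "X \<in> P"
  shows "restr X n \<in> AP"
proof -
  obtain A S where X: "X = (A, S)" by (cases X)
  define F where "F = first_elems A n"
  have inf: "infinite A" and sub: "S \<subseteq> {u. u \<subseteq> A \<and> finite u}"
    and her: "\<And>u v. u \<subseteq> v \<Longrightarrow> v \<in> S \<Longrightarrow> u \<in> S" and un: "\<Union>S = A"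
    by (fact in_P_D[OF assms[unfolded X]])+
  have FA: "F \<subseteq> A" and fin: "finite F"
    using first_elems_subset[OF inf] by (auto simp: F_def first_elems_def)
  have ne: "S \<noteq> {}" using un inf by auto
  let ?T = "{u \<inter> F | u. u \<in> S}"
  have 1: "?T \<subseteq> {u. u \<subseteq> F \<and> finite u}" using fin by auto
  have 2: "u \<in> ?T" if "u \<subseteq> v" "v \<in> ?T" for u v
  proof -
    from that obtain w where w: "v = w \<inter> F" "w \<in> S" by blast
    have "u \<in> S" using her[of u w] w that by blast
    moreover have "u = u \<inter> F" using w that by blast
    ultimately show ?thesis by blast
  qed
  have 3: "\<Union>?T = F" using un FA by blast
  have 4: "?T = {{}}" if "F = {}" using that ne by auto
  have "hereditary_pair (F, ?T)"
    unfolding hereditary_pair_def prod.case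
  proof (intro conjI allI impI)
    show "u \<in> ?T" if "u \<subseteq> v \<and> v \<in> ?T" for u v
      using 2[OF conjunct1[OF that] conjunct2[OF that]] .
  qed (fact 1, fact 3, rule 4)
  then have "(F, ?T) \<in> AP" using fin by (simp add: AP_def)
  then show ?thesis by (simp add: restr_def X F_def)
qed

lemma restr_in_AP_le:
  assumes "X \<in> P_le k"
  shows "restr X n \<in> AP_le k"
proof -
  obtain A S where X: "X = (A, S)" by (cases X)
  have "X \<in> P" and sub: "S \<subseteq> {u. u \<subseteq> A \<and> finite u \<and> card u \<le> k}"
    using assms unfolding P_le_def X by auto
  then have "restr X n \<in> AP" by (simp add: restr_in_AP)
  moreover have "card (u \<inter> F) \<le> k" if "u \<in> S" for u F
  proof -
    have "card (u \<inter> F) \<le> card u" using that sub by (intro card_mono) auto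
    then show ?thesis using that sub by fastforce
  qed
  moreover have "finite (u \<inter> F)" if "u \<in> S" for u F
    using that sub by auto
  ultimately show ?thesis
    unfolding AP_le_def restr_def X by auto
qed

lemma inj_on_restr: "inj_on restr P"
proof (rule inj_onI)
  have main: "fst X \<subseteq> fst Y \<and> snd X \<subseteq> snd Y" if "X \<in> P" "Y \<in> P" and eq: "restr X = restr Y" for X Y
  proof -
    obtain A S B T where X: "X = (A, S)" and Y: "Y = (B, T)" by (cases X, cases Y)
    note A = in_P_D[OF that(1)[unfolded X]] and B = in_P_D[OF that(2)[unfolded Y]]
    have inf: "infinite A" "infinite B" and sub: "S \<subseteq> {u. u \<subseteq> A \<and> finite u}"
      and her: "\<And>u v. u \<subseteq> v \<Longrightarrow> v \<in> T \<Longrightarrow> u \<in> T"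
      by (fact A B)+
    have "restr (A, S) n = restr (B, T) n" for n using eq by (simp only: X Y)
    then have fe: "first_elems A n = first_elems B n"
      and tr: "{u \<inter> first_elems A n | u. u \<in> S} = {u \<inter> first_elems B n | u. u \<in> T}" for n
      unfolding restr_def prod.case prod.inject by (rule conjunct1, rule conjunct2)
    have ex: "\<exists>n. x \<in> first_elems A n" if "x \<in> A" for x
    proof -
      obtain m where "enumerate A m = x" using enumerate_Ex[of A x] inf \<open>x \<in> A\<close> by auto
      then show ?thesis unfolding first_elems_def by (intro exI[of _ "Suc m"]) auto
    qed
    have "A \<subseteq> B" unfolding subset_iff using ex fe first_elems_subset[OF inf(2)] by (metis subsetD)
    moreover have "u \<in> T" if u: "u \<in> S" for u
    proof -
      have "finite u" "u \<subseteq> A" using u sub by auto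
      then have "\<exists>n. u \<subseteq> first_elems A n"
      proof (induction u rule: finite_induct)
        case (insert x u)
        then obtain n m where "u \<subseteq> first_elems A n" "x \<in> first_elems A m" using ex by blast
        then have "insert x u \<subseteq> first_elems A (max n m)"
          by (fastforce simp: first_elems_def)
        then show ?case ..
      qed simp
      then obtain n where n: "u \<subseteq> first_elems A n" ..
      then have "u \<in> {u \<inter> first_elems A n | u. u \<in> S}" using u by blast
      then obtain v where "v \<in> T" "u = v \<inter> first_elems B n" unfolding tr by blast
      then show ?thesis using her by blast
    qed
    ultimately show ?thesis by (auto simp: X Y)
  qed
  show "X = Y" if "X \<in> P" "Y \<in> P" "restr X = restr Y" for X Y
    using main[of X Y] main[of Y X] that by (auto simp: prod_eq_iff)
qed

end

(* Since T <= S is allowed to drop faces, every nonempty basic set [a, A] contains a point B whose only faces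
   are those of a and the vertices (singletons and the empty set). Below such a B a point is determined
   by its vertex set, so [a, B] is a copy of a basic set of Ellentuck's space of infinite subsets of the
   naturals; open sets pull back to open sets, nowhere dense sets to Ramsey null sets, and Ellentuck's theorem
   gives the Ramsey properties. Closedness holds because membership in P(k) is decided by the finite
   approximations one at a time. *)

theory Submission
  imports Defs
begin

section \<open>Initial segments and Ellentuck neighbourhoods\<close>

definition beyond :: "nat set \<Rightarrow> nat set" where
  "beyond s = {n. \<forall>m\<in>s. m < n}"

definition ellentuck :: "nat set \<Rightarrow> nat set \<Rightarrow> nat set set" where
  "ellentuck s A = {B. infinite B \<and> s \<subseteq> B \<and> B - s \<subseteq> A \<inter> beyond s}"

lemma beyond_empty [simp]: "beyond {} = UNIV"
  by (simp add: beyond_def)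

lemma infinite_Int_beyond:
  assumes "infinite A" "finite s"
  shows "infinite (A \<inter> beyond s)"
proof
  assume "finite (A \<inter> beyond s)"
  moreover have "A \<subseteq> (A \<inter> beyond s) \<union> (\<Union>m\<in>s. {..m})"
    by (auto simp: beyond_def not_less)
  ultimately show False
    using assms by (meson finite_UN_I finite_UnI finite_atMost finite_subset)
qed

lemma first_elems_eq_Int:
  assumes "infinite A"
  shows "first_elems A n = A \<inter> {..<enumerate A n}"
proof
  show "first_elems A n \<subseteq> A \<inter> {..<enumerate A n}"
    using assms by (auto simp: first_elems_def enumerate_in_set)
  show "A \<inter> {..<enumerate A n} \<subseteq> first_elems A n"
  proof
    fix a assume a: "a \<in> A \<inter> {..<enumerate A n}"
    then obtain i where i: "enumerate A i = a" using enumerate_Ex[of A a] assms by auto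
    then have "i < n" using a assms by auto
    then show "a \<in> first_elems A n" using i by (auto simp: first_elems_def)
  qed
qed

lemma finite_first_elems [simp]: "finite (first_elems A n)"
  by (simp add: first_elems_def)

lemma card_first_elems: "infinite A \<Longrightarrow> card (first_elems A n) = n"
  unfolding first_elems_def by (simp add: card_image inj_on_subset[OF inj_enumerate])

lemma first_elems_beyond: "infinite A \<Longrightarrow> A - first_elems A n \<subseteq> beyond (first_elems A n)"
  by (auto simp: first_elems_eq_Int beyond_def)

text \<open>Both sets are initial segments of \<open>C\<close>. If neither contained the other, a
  point of each difference would be smaller than the other one. Comparable finite sets of equal
  cardinality coincide.\<close>

lemma first_elems_unique:
  assumes C: "infinite C" and F: "F \<subseteq> C" "finite F" "C - F \<subseteq> beyond F"
  shows "first_elems C (card F) = F"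
proof -
  let ?G = "first_elems C (card F)"
  have G: "?G \<subseteq> C" "C - ?G \<subseteq> beyond ?G" "card ?G = card F"
    using first_elems_subset first_elems_beyond card_first_elems C by auto
  have "F \<subseteq> ?G \<or> ?G \<subseteq> F"
  proof (rule ccontr)
    assume "\<not> (F \<subseteq> ?G \<or> ?G \<subseteq> F)"
    then obtain a b where "a \<in> F" "a \<notin> ?G" "b \<in> ?G" "b \<notin> F" by blast
    then have "a < b" "b < a" using F G unfolding beyond_def by blast+
    then show False by simp
  qed
  then show ?thesis using F G card_subset_eq[of F ?G] card_subset_eq[of ?G F] by auto
qed

lemma ellentuck_initial: "finite s \<Longrightarrow> B \<in> ellentuck s A \<Longrightarrow> first_elems B (card s) = s"
  by (rule first_elems_unique) (auto simp: ellentuck_def)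

lemma ellentuck_infinite: "B \<in> ellentuck s A \<Longrightarrow> infinite B"
  by (simp add: ellentuck_def)

lemma ellentuck_mono: "A \<subseteq> B \<Longrightarrow> ellentuck s A \<subseteq> ellentuck s B"
  by (auto simp: ellentuck_def)

text \<open>\<open>beyond\<close> reverses inclusion, so a point above \<open>s\<close> is
  automatically above \<open>t\<close>. This removes the tail restrictions produced by
  \<open>fusion\<close>.\<close>

lemma ellentuck_Int_beyond: "t \<subseteq> s \<Longrightarrow> ellentuck s (A \<inter> beyond t) = ellentuck s A"
  by (fastforce simp: ellentuck_def beyond_def)

lemma join_in_ellentuck:
  assumes "finite s" "infinite B"
  shows "s \<union> (B \<inter> beyond s) \<in> ellentuck s B"
  using assms infinite_Int_beyond[of B s] by (auto simp: ellentuck_def)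

lemma ellentuck_join: "ellentuck s (s \<union> (B \<inter> beyond s)) = ellentuck s B"
  by (auto simp: ellentuck_def)

text \<open>Diagonalization: pick points one at a time. Only finitely many stems \<open>t\<close>
  lie up to the latest point, so the remaining reservoir can be shrunk to suit all of them before
  the next point is picked. Every later point comes from that reservoir, and \<open>R t\<close>
  passes to infinite subsets.\<close>

lemma fusion:
  fixes R :: "nat set \<Rightarrow> nat set \<Rightarrow> bool"
  assumes hered: "\<And>t A B. R t A \<Longrightarrow> B \<subseteq> A \<Longrightarrow> infinite B \<Longrightarrow> R t B"
    and dense: "\<And>t A. finite t \<Longrightarrow> infinite A \<Longrightarrow> \<exists>B\<subseteq>A. infinite B \<and> R t B"
    and A: "infinite A"
  shows "\<exists>B\<subseteq>A. infinite B \<and> (\<forall>t\<subseteq>B. finite t \<longrightarrow> R t (B \<inter> beyond t))"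
proof -
  have dense_finite: "\<exists>B\<subseteq>A. infinite B \<and> (\<forall>t\<in>F. R t B)"
    if "finite F" "\<forall>t\<in>F. finite t" "infinite A" for F A
    using that
  proof (induction F)
    case (insert t F)
    then obtain B where B: "B \<subseteq> A" "infinite B" "\<forall>t\<in>F. R t B" by auto
    obtain C where "C \<subseteq> B" "infinite C" "R t C" using dense[of t B] insert B by auto
    then show ?case using B hered by (intro exI[of _ C]) auto
  qed auto
  define lst where "lst C = (LEAST n. n \<in> C)" for C :: "nat set"
  have lst_in: "lst C \<in> C" if "infinite C" for C
    unfolding lst_def using that by (metis LeastI finite.emptyI ex_in_conv)
  \<comment> \<open>The empty stem is settled first: \<open>beyond {}\<close> is everything, so here
    the whole diagonal set, including its first point, must lie in a suitable set.\<close>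
  obtain A0 where A0: "A0 \<subseteq> A" "infinite A0" "R {} A0" using dense[of "{}" A] A by auto
  \<comment> \<open>\<open>f n\<close> is the reservoir at stage \<open>n\<close>, and its least
    element is the point picked there.\<close>
  have "\<exists>f. \<forall>n. (infinite (f n) \<and> f n \<subseteq> A0) \<and>
      (f (Suc n) \<subseteq> f n \<inter> {lst (f n)<..} \<and> (\<forall>t\<in>Pow {..lst (f n)}. R t (f (Suc n))))"
  proof (rule dependent_nat_choice)
    show "\<exists>C. infinite C \<and> C \<subseteq> A0" using A0 by blast
  next
    fix C and n :: nat
    assume C: "infinite C \<and> C \<subseteq> A0"
    have "infinite (C \<inter> {lst C<..})"
      using infinite_Int_beyond[of C "{lst C}"] C by (simp add: beyond_def greaterThan_def)
    then obtain D where "D \<subseteq> C \<inter> {lst C<..}" "infinite D" "\<forall>t\<in>Pow {..lst C}. R t D"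
      using dense_finite[of "Pow {..lst C}" "C \<inter> {lst C<..}"] finite_subset[OF _ finite_atMost] by auto
    then show "\<exists>D. (infinite D \<and> D \<subseteq> A0) \<and>
        D \<subseteq> C \<inter> {lst C<..} \<and> (\<forall>t\<in>Pow {..lst C}. R t D)"
      using C by blast
  qed
  then obtain f where inf: "\<And>n. infinite (f n)" and fA0: "\<And>n. f n \<subseteq> A0"
    and dec: "\<And>n. f (Suc n) \<subseteq> f n \<inter> {lst (f n)<..}"
    and R: "\<And>n t. t \<subseteq> {..lst (f n)} \<Longrightarrow> R t (f (Suc n))"
    by blast
  define x where "x n = lst (f n)" for n
  have anti: "f n \<subseteq> f m" if "m \<le> n" for m n
    by (rule lift_Suc_antimono_le[OF _ that]) (use dec in blast)
  have mono: "strict_mono x"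
  proof (unfold strict_mono_Suc_iff x_def, rule allI)
    show "lst (f n) < lst (f (Suc n))" for n
      using subsetD[OF dec[of n] lst_in[OF inf[of "Suc n"]]] by simp
  qed
  have x_in: "x n \<in> f n" for n unfolding x_def using lst_in[OF inf] .
  have infx: "infinite (range x)"
    using mono by (simp add: range_inj_infinite strict_mono_imp_inj_on)
  show ?thesis
  proof (intro exI[of _ "range x"] conjI allI impI)
    show "infinite (range x)" by fact
    show "range x \<subseteq> A" using x_in fA0 A0 by blast
    show "R t (range x \<inter> beyond t)" if t: "t \<subseteq> range x" "finite t" for t
    proof (cases "t = {}")
      case True
      then show ?thesis using hered[OF A0(3), of "range x"] infx x_in fA0 by auto
    next
      case False
      then obtain n where n: "Max t = x n" using t Max_in by blast
      have "R t (f (Suc n))" by (rule R) (use Max_ge[OF t(2)] n in \<open>auto simp: x_def\<close>)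
      moreover have "range x \<inter> beyond t \<subseteq> f (Suc n)"
      proof
        fix y assume y: "y \<in> range x \<inter> beyond t"
        then obtain m where m: "y = x m" by blast
        have "x n < x m" using y m n Max_in[OF t(2) False] by (auto simp: beyond_def)
        then have "Suc n \<le> m" using mono by (simp add: strict_mono_less)
        then show "y \<in> f (Suc n)" using m x_in anti by blast
      qed
      ultimately show ?thesis using hered infinite_Int_beyond[OF infx t(2)] by blast
    qed
  qed
qed

section \<open>Ellentuck's theorem\<close>

text \<open>For infinite \<open>B\<close>, the sets \<open>C\<close> quantified here form the basic
  Ellentuck neighbourhood of \<open>B\<close> whose stem is the part of \<open>B\<close> below
  \<open>m\<close>.\<close>

definition ellentuck_open :: "nat set set \<Rightarrow> bool" where
  "ellentuck_open U \<longleftrightarrow>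
     (\<forall>B\<in>U. \<exists>m. \<forall>C\<subseteq>B. infinite C \<and> C \<inter> {..<m} = B \<inter> {..<m} \<longrightarrow> C \<in> U)"

text \<open>Galvin and Prikry's acceptance and rejection argument.\<close>

lemma ellentuck_open_Ramsey:
  assumes U: "ellentuck_open U" and s: "finite s" and A: "infinite A"
  obtains B where "infinite B" "B \<subseteq> A" "ellentuck s B \<subseteq> U \<or> ellentuck s B \<inter> U = {}"
proof -
  \<comment> \<open>Acceptance passes to all subsets, and so does rejection, which says that no
    infinite subset accepts. Hence the property of being decided is suitable for
    \<open>fusion\<close>.\<close>
  define acc where "acc t C \<longleftrightarrow> ellentuck t C \<subseteq> U" for t C
  define rej where "rej t C \<longleftrightarrow> (\<forall>D\<subseteq>C. infinite D \<longrightarrow> \<not> acc t D)" for t C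
  have acc_mono: "acc t D" if "acc t C" "D \<subseteq> C" for t C D
    using that ellentuck_mono unfolding acc_def by blast
  have "\<exists>A1\<subseteq>A \<inter> beyond s. infinite A1 \<and> (\<forall>t\<subseteq>A1. finite t \<longrightarrow>
      acc (s \<union> t) (A1 \<inter> beyond t) \<or> rej (s \<union> t) (A1 \<inter> beyond t))"
  proof (rule fusion)
    show "infinite (A \<inter> beyond s)" using infinite_Int_beyond A s .
    show "acc (s \<union> t) D \<or> rej (s \<union> t) D"
      if "acc (s \<union> t) C \<or> rej (s \<union> t) C" "D \<subseteq> C" for t C D
      using that acc_mono unfolding rej_def by (meson subset_trans)
    show "\<exists>D\<subseteq>C. infinite D \<and> (acc (s \<union> t) D \<or> rej (s \<union> t) D)" if "infinite C" for t C
      using that unfolding rej_def by (cases "\<exists>D\<subseteq>C. infinite D \<and> acc (s \<union> t) D") auto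
  qed
  then obtain A1 where A1: "infinite A1" "A1 \<subseteq> A \<inter> beyond s"
    and dec: "\<And>t. finite t \<Longrightarrow> t \<subseteq> A1 \<Longrightarrow>
      acc (s \<union> t) (A1 \<inter> beyond t) \<or> rej (s \<union> t) (A1 \<inter> beyond t)"
    by blast
  \<comment> \<open>Fusion decides only on the tail above \<open>t\<close>. Both notions depend on
    that tail alone, so \<open>A1\<close> itself decides every stem.\<close>
  have decides: "acc (s \<union> t) A1 \<or> rej (s \<union> t) A1" if "finite t" "t \<subseteq> A1" for t
    using dec[OF that]
  proof
    assume "acc (s \<union> t) (A1 \<inter> beyond t)"
    then show ?thesis by (simp add: acc_def ellentuck_Int_beyond)
  next
    assume r: "rej (s \<union> t) (A1 \<inter> beyond t)"
    have "\<not> acc (s \<union> t) D" if "D \<subseteq> A1" "infinite D" for D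
    proof -
      have "\<not> acc (s \<union> t) (D \<inter> beyond t)"
        using r infinite_Int_beyond[OF \<open>infinite D\<close> \<open>finite t\<close>] \<open>D \<subseteq> A1\<close> unfolding rej_def by blast
      then show ?thesis by (simp add: acc_def ellentuck_Int_beyond)
    qed
    then show ?thesis by (simp add: rej_def)
  qed
  show thesis
  proof (cases "acc s A1")
    case True
    then show ?thesis using that[of A1] A1 by (auto simp: acc_def)
  next
    case False
    then have rej_s: "rej s A1" using decides[of "{}"] by simp
    \<comment> \<open>A second fusion makes rejection pass from a stem to its one-point end
      extensions. The premise makes \<open>R\<close> vacuous for the stems that do not
      matter.\<close>
    define R where "R t C \<longleftrightarrow> (t \<subseteq> A1 \<and> rej (s \<union> t) A1 \<longrightarrow>
      (\<forall>n\<in>C \<inter> A1 \<inter> beyond t. rej (s \<union> insert n t) A1))" for t C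
    have dense: "\<exists>D\<subseteq>C. infinite D \<and> R t D" if t: "finite t" and C: "infinite C" for t C
    proof (cases "t \<subseteq> A1 \<and> rej (s \<union> t) A1")
      case False
      then show ?thesis using C by (auto simp: R_def)
    next
      case True
      \<comment> \<open>By \<open>decides\<close>, \<open>D\<close> collects the extensions that are
        accepted. The least new point of any \<open>X\<close> in
        \<open>ellentuck (s \<union> t) D\<close> lies in \<open>D\<close>, so \<open>D\<close>
        would accept the rejected stem \<open>s \<union> t\<close>. Hence \<open>D\<close> is finite
        and can be removed from \<open>C\<close>.\<close>
      define D where "D = {n \<in> C \<inter> A1 \<inter> beyond t. \<not> rej (s \<union> insert n t) A1}"
      have acc_D: "acc (s \<union> insert n t) A1" if "n \<in> D" for n
        using decides[of "insert n t"] that t True by (auto simp: D_def)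
      have "acc (s \<union> t) D"
        unfolding acc_def
      proof
        fix X assume X: "X \<in> ellentuck (s \<union> t) D"
        then have "infinite (X - (s \<union> t))" using s t by (auto simp: ellentuck_def)
        then have "\<exists>y. y \<in> X - (s \<union> t)" by (metis ex_in_conv finite.emptyI)
        then obtain n where n: "n \<in> X - (s \<union> t)" "\<And>y. y \<in> X - (s \<union> t) \<Longrightarrow> n \<le> y"
          unfolding exists_least_iff[of "\<lambda>y. y \<in> X - (s \<union> t)"] using leI by blast
        then have "n \<in> D" using X by (auto simp: ellentuck_def)
        moreover have "X \<in> ellentuck (s \<union> insert n t) A1"
        proof -
          have "n < y" if "y \<in> X - (s \<union> insert n t)" for y
            using n(2)[of y] that by (cases "n = y") auto
          then show ?thesis
            using X n(1) unfolding ellentuck_def beyond_def D_def by blast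
        qed
        ultimately show "X \<in> U" using acc_D unfolding acc_def by blast
      qed
      moreover have "D \<subseteq> A1" by (auto simp: D_def)
      ultimately have "finite D" using True unfolding rej_def by blast
      then have "infinite (C - D)" using C by simp
      moreover have "R t (C - D)" by (auto simp: R_def D_def)
      ultimately show ?thesis by blast
    qed
    have "\<exists>A2\<subseteq>A1. infinite A2 \<and> (\<forall>t\<subseteq>A2. finite t \<longrightarrow> R t (A2 \<inter> beyond t))"
    proof (rule fusion)
      show "R t D" if "R t C" "D \<subseteq> C" for t C D
        using that unfolding R_def by blast
    qed (fact dense A1)+
    then obtain A2 where A2: "infinite A2" "A2 \<subseteq> A1"
      and RA2: "\<And>t. finite t \<Longrightarrow> t \<subseteq> A2 \<Longrightarrow> R t (A2 \<inter> beyond t)"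
      by blast
    have rej_A2: "rej (s \<union> t) A1" if "finite t" "t \<subseteq> A2" for t
      using that
    proof (induction t rule: finite_linorder_max_induct)
      case empty
      then show ?case using rej_s by simp
    next
      case (insert n t)
      then have "n \<in> A2 \<inter> beyond t \<inter> A1" using A2 by (auto simp: beyond_def)
      then show ?case using RA2[of t] insert A2 unfolding R_def by blast
    qed
    have "ellentuck s A2 \<inter> U = {}"
    proof (rule ccontr)
      assume "ellentuck s A2 \<inter> U \<noteq> {}"
      then obtain X where X: "X \<in> ellentuck s A2" "X \<in> U" by blast
      obtain m where m: "\<forall>C\<subseteq>X. infinite C \<and> C \<inter> {..<m} = X \<inter> {..<m} \<longrightarrow> C \<in> U"
        using bspec[OF U[unfolded ellentuck_open_def] X(2)] by (elim exE)
      obtain m' where m': "s \<subseteq> {..<m'}" using s finite_nat_iff_bounded by blast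
      \<comment> \<open>The cut is at least \<open>m\<close>, so that openness puts every set of
        \<open>ellentuck t (X - s)\<close> into \<open>U\<close>, and at least \<open>m'\<close>, so
        that \<open>t\<close> contains \<open>s\<close>. Then \<open>X - s\<close> accepts the
        rejected stem \<open>t\<close>.\<close>
      define t where "t = X \<inter> {..<max m m'}"
      have st: "s \<subseteq> t" using X m' by (auto simp: t_def ellentuck_def)
      have "acc t (X - s)"
        unfolding acc_def
      proof
        fix C assume "C \<in> ellentuck t (X - s)"
        then have C: "infinite C" "t \<subseteq> C" "C - t \<subseteq> X" by (auto simp: ellentuck_def)
        then have "C \<subseteq> X" by (auto simp: t_def)
        moreover have "C \<inter> {..<m} = X \<inter> {..<m}" using C \<open>C \<subseteq> X\<close> by (auto simp: t_def)
        ultimately show "C \<in> U" using m C by blast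
      qed
      moreover have "X - s \<subseteq> A1" "infinite (X - s)" using X A2 s by (auto simp: ellentuck_def)
      moreover have "rej t A1"
      proof -
        have "t - s \<subseteq> A2" using X by (auto simp: t_def ellentuck_def)
        then show ?thesis
          using rej_A2[of "t - s"] st by (simp add: t_def Un_absorb1)
      qed
      ultimately show False unfolding rej_def by blast
    qed
    then show ?thesis using that[of A2] A1 A2 by blast
  qed
qed

text \<open>Fusion arranges that adding \<open>t\<close> to the stem avoids \<open>X i\<close> for
  all \<open>i \<le> card t\<close>, finitely many conditions per stem. A member of
  \<open>X i\<close> would be excluded by the stem formed from \<open>s\<close> and its first
  \<open>i\<close> further elements.\<close>

lemma ellentuck_null_Union:
  fixes X :: "nat \<Rightarrow> nat set set"
  assumes null: "\<And>i t A. finite t \<Longrightarrow> s \<subseteq> t \<Longrightarrow> infinite A \<Longrightarrow>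
      \<exists>B\<subseteq>A. infinite B \<and> ellentuck t B \<inter> X i = {}"
    and s: "finite s" and A: "infinite A"
  shows "\<exists>B\<subseteq>A. infinite B \<and> ellentuck s B \<inter> (\<Union>i. X i) = {}"
proof -
  define R where "R t C \<longleftrightarrow> (\<forall>i\<le>card t. ellentuck (s \<union> t) C \<inter> X i = {})" for t C
  have "\<exists>B\<subseteq>A. infinite B \<and> (\<forall>i\<le>n. ellentuck (s \<union> t) B \<inter> X i = {})"
    if "finite t" "infinite A" for t A n
  proof (induction n)
    case 0
    then show ?case using null[of "s \<union> t" A 0] that s by auto
  next
    case (Suc n)
    then obtain B where B: "B \<subseteq> A" "infinite B" "\<forall>i\<le>n. ellentuck (s \<union> t) B \<inter> X i = {}" by blast
    then obtain C where C: "C \<subseteq> B" "infinite C" "ellentuck (s \<union> t) C \<inter> X (Suc n) = {}"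
      using null[of "s \<union> t" B "Suc n"] \<open>finite t\<close> s by auto
    have "ellentuck (s \<union> t) C \<inter> X i = {}" if "i \<le> n" for i
      using B(3) that ellentuck_mono[OF \<open>C \<subseteq> B\<close>, of "s \<union> t"] by blast
    then show ?case
      using B(1) C by (intro exI[of _ C]) (auto simp: le_Suc_eq)
  qed
  then have dense: "\<exists>B\<subseteq>A. infinite B \<and> R t B" if "finite t" "infinite A" for t A
    using that unfolding R_def by blast
  have "\<exists>B\<subseteq>A \<inter> beyond s. infinite B \<and> (\<forall>t\<subseteq>B. finite t \<longrightarrow> R t (B \<inter> beyond t))"
  proof (rule fusion)
    show "R t D" if "R t C" "D \<subseteq> C" for t C D
      using that ellentuck_mono[of D C] unfolding R_def by blast
    show "infinite (A \<inter> beyond s)" using infinite_Int_beyond A s .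
  qed (fact dense)
  then obtain B where B: "infinite B" "B \<subseteq> A \<inter> beyond s"
    and R: "\<And>t. finite t \<Longrightarrow> t \<subseteq> B \<Longrightarrow> R t (B \<inter> beyond t)"
    by blast
  have "ellentuck s B \<inter> X i = {}" for i
  proof (rule ccontr)
    assume "ellentuck s B \<inter> X i \<noteq> {}"
    then obtain Y where Y: "Y \<in> ellentuck s B" "Y \<in> X i" by blast
    define Z where "Z = Y - s"
    have Z: "infinite Z" "Z \<subseteq> B" "Y = s \<union> Z" "Z \<subseteq> beyond s"
      using Y s by (auto simp: Z_def ellentuck_def)
    define t where "t = first_elems Z i"
    have t: "t = Z \<inter> {..<enumerate Z i}"
      unfolding t_def using Z(1) by (rule first_elems_eq_Int)
    have "card t = i"
      unfolding t_def using Z(1) by (rule card_first_elems)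
    moreover have "Y \<in> ellentuck (s \<union> t) (B \<inter> beyond t)"
      using Z unfolding ellentuck_def t beyond_def by auto
    moreover have "finite t" "t \<subseteq> B" using t Z by auto
    ultimately show False using R[of t] Y(2) unfolding R_def by blast
  qed
  then show ?thesis using B by blast
qed

section \<open>Approximations in the space of bounded families\<close>

text \<open>The first \<open>n\<close> vertices of \<open>E\<close> form an initial segment of the
  common approximation, hence of \<open>C\<close>. Faces are compared by restricting twice: the
  trace on the smaller set depends only on the trace on the larger one.\<close>

lemma restr_coherent:
  assumes C: "C \<in> P" and E: "E \<in> P" and eq: "restr C j = restr E m" and n: "n \<le> m"
  shows "restr C n = restr E n"
proof -
  obtain A S where CA: "C = (A, S)" by (cases C)
  obtain B T where EB: "E = (B, T)" by (cases E)
  have inf: "infinite A" "infinite B" using in_P_D(1) C E CA EB by auto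
  have F: "first_elems A j = first_elems B m"
    and tr: "{u \<inter> first_elems A j | u. u \<in> S} = {u \<inter> first_elems B m | u. u \<in> T}"
    using eq unfolding CA EB restr_def prod.case prod.inject by (rule conjunct1, rule conjunct2)
  have sub: "first_elems B n \<subseteq> first_elems B m" using n by (auto simp: first_elems_def)
  have "first_elems A (card (first_elems B n)) = first_elems B n"
  proof (rule first_elems_unique)
    show "first_elems B n \<subseteq> A" using sub F first_elems_subset[OF inf(1)] by blast
    show "A - first_elems B n \<subseteq> beyond (first_elems B n)"
    proof
      fix y assume y: "y \<in> A - first_elems B n"
      show "y \<in> beyond (first_elems B n)"
      proof (cases "y \<in> first_elems B m")
        case True
        then show ?thesis
          using y first_elems_beyond[OF inf(2)] first_elems_subset[OF inf(2)] by blast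
      next
        case False
        then have "y \<in> beyond (first_elems B m)" using y F first_elems_beyond[OF inf(1), of j] by auto
        then show ?thesis using sub by (auto simp: beyond_def)
      qed
    qed
  qed (use inf in auto)
  then have Fn: "first_elems A n = first_elems B n" using inf by (simp add: card_first_elems)
  have img: "{u \<inter> G | u. u \<in> Q} = (\<lambda>u. u \<inter> G) ` {u \<inter> H | u. u \<in> Q}"
    if "G \<subseteq> H" for G H :: "nat set" and Q
  proof -
    have "u \<inter> H \<inter> G = u \<inter> G" for u using that by blast
    then show ?thesis by (simp add: Setcompr_eq_image image_image)
  qed
  have "{u \<inter> first_elems B n | u. u \<in> S} = {u \<inter> first_elems B n | u. u \<in> T}"
    using img[OF sub, of S] img[OF sub, of T] tr[unfolded F] by (simp only:)
  then show ?thesis using Fn by (simp add: CA EB restr_def)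
qed

lemma hfam_le_trans: "hfam_le A B \<Longrightarrow> hfam_le B C \<Longrightarrow> hfam_le A C"
  by (auto simp: hfam_le_def)

lemma P_le_subset_P: "P_le k \<subseteq> P"
  by (auto simp: P_le_def)

abbreviation nbhd :: "nat \<Rightarrow> hfam \<Rightarrow> hfam \<Rightarrow> hfam set" where
  "nbhd k \<equiv> Ramsey_nbhd (P_le k) hfam_le restr"

abbreviation P_topology :: "nat \<Rightarrow> hfam topology" where
  "P_topology k \<equiv> Ramsey_topology (P_le k) (AP_le k) hfam_le restr"

lemma openin_nbhd: "a \<in> AP_le k \<Longrightarrow> A \<in> P_le k \<Longrightarrow> openin (P_topology k) (nbhd k a A)"
  unfolding Ramsey_topology_def by (rule topology_generated_by_Basis) blast

text \<open>The sets \<open>nbhd k (restr E n) E\<close> decrease with \<open>n\<close> by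
  coherence, which handles intersections. Transitivity of \<open>hfam_le\<close> puts one of them
  inside any generating set containing \<open>E\<close>. So they behave as a neighbourhood base at
  \<open>E\<close>.\<close>

lemma openin_P_topologyD:
  assumes "openin (P_topology k) U" "E \<in> U"
  shows "\<exists>n. nbhd k (restr E n) E \<subseteq> U"
proof -
  have mono: "nbhd k (restr E m) E \<subseteq> nbhd k (restr E n) E" if "E \<in> P_le k" "n \<le> m" for E n m
  proof
    fix C assume "C \<in> nbhd k (restr E m) E"
    then obtain j where C: "C \<in> P_le k" "hfam_le C E" "restr C j = restr E m"
      by (auto simp: Ramsey_nbhd_def)
    then have "restr C n = restr E n"
      using restr_coherent[OF _ _ C(3) that(2)] that(1) P_le_subset_P by blast
    then show "C \<in> nbhd k (restr E n) E" using C by (auto simp: Ramsey_nbhd_def)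
  qed
  have "generate_topology_on {nbhd k a A | a A. a \<in> AP_le k \<and> A \<in> P_le k} U"
    using assms(1) unfolding Ramsey_topology_def openin_topology_generated_by_iff .
  then have "U \<subseteq> P_le k \<and> (\<forall>E\<in>U. \<exists>n. nbhd k (restr E n) E \<subseteq> U)"
  proof (induction rule: generate_topology_on.induct)
    case Empty
    show ?case by simp
  next
    case (Int U V)
    have "\<exists>n. nbhd k (restr E n) E \<subseteq> U \<inter> V" if "E \<in> U \<inter> V" for E
    proof -
      have "E \<in> U" "E \<in> V" using that by auto
      then obtain n where n: "nbhd k (restr E n) E \<subseteq> U" using Int.IH(1) by blast
      obtain m where m: "nbhd k (restr E m) E \<subseteq> V" using Int.IH(2) \<open>E \<in> V\<close> by blast
      have E: "E \<in> P_le k" using Int.IH(1) \<open>E \<in> U\<close> by blast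
      have "nbhd k (restr E (max n m)) E \<subseteq> U \<inter> V"
        using mono[OF E max.cobounded1[of n m]] mono[OF E max.cobounded2[of m n]] n m by blast
      then show ?thesis ..
    qed
    then show ?case using Int.IH(1) by blast
  next
    case (UN K)
    have "\<exists>n. nbhd k (restr E n) E \<subseteq> \<Union>K" if "E \<in> \<Union>K" for E
    proof -
      from that obtain V where V: "V \<in> K" "E \<in> V" by blast
      then obtain n where "nbhd k (restr E n) E \<subseteq> V" using UN.IH[OF V(1)] by blast
      then show ?thesis using V(1) by blast
    qed
    moreover have "\<Union>K \<subseteq> P_le k" using UN.IH by (intro Union_least) blast
    ultimately show ?case by blast
  next
    case (Basis U)
    then obtain a A where U: "U = nbhd k a A" by blast
    have "\<exists>n. nbhd k (restr E n) E \<subseteq> U" if "E \<in> U" for E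
    proof -
      from that obtain n where n: "restr E n = a" and le: "hfam_le E A"
        by (auto simp: U Ramsey_nbhd_def)
      have "nbhd k (restr E n) E \<subseteq> U"
        unfolding U Ramsey_nbhd_def n using hfam_le_trans[OF _ le] by blast
      then show ?thesis ..
    qed
    moreover have "U \<subseteq> P_le k" by (auto simp: U Ramsey_nbhd_def)
    ultimately show ?case by blast
  qed
  then show ?thesis using assms(2) by blast
qed

section \<open>Spreading a finite family over an infinite set\<close>

text \<open>For infinite \<open>B\<close> this gives a point of the space, for finite
  \<open>B\<close> an approximation. Singletons are added so that every element of \<open>B\<close>
  is a vertex; vertices outside \<open>\<Union>S\<close> are isolated.\<close>

definition spread :: "nat set set \<Rightarrow> nat set \<Rightarrow> hfam" where
  "spread S B = (B, {u \<in> S. u \<subseteq> B} \<union> insert {} ((\<lambda>b. {b}) ` B))"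

locale bounded_family =
  fixes k :: nat and S :: "nat set set"
  assumes k_pos: "k > 0"
    and hered: "\<And>u v. u \<subseteq> v \<Longrightarrow> v \<in> S \<Longrightarrow> u \<in> S"
    and bound: "\<And>u. u \<in> S \<Longrightarrow> finite u \<and> card u \<le> k"
begin

abbreviation pull :: "hfam set \<Rightarrow> nat set set" where
  "pull X \<equiv> {B. infinite B \<and> spread S B \<in> X}"

lemma spread_in_P_le:
  assumes "infinite B"
  shows "spread S B \<in> P_le k"
proof -
  let ?T = "{u \<in> S. u \<subseteq> B} \<union> insert {} ((\<lambda>b. {b}) ` B)"
  have "u \<in> ?T" if "u \<subseteq> v" "v \<in> ?T" for u v
  proof -
    from that(2) consider "v \<in> S" "v \<subseteq> B" | "v = {}" | b where "b \<in> B" "v = {b}" by blast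
    then show ?thesis
    proof cases
      case 1
      then show ?thesis using hered[OF that(1)] that(1) by blast
    qed (use that(1) in \<open>auto simp: subset_singleton_iff\<close>)
  qed
  \<comment> \<open>Positivity of \<open>k\<close> is what admits the singletons.\<close>
  moreover have "?T \<subseteq> {u. u \<subseteq> B \<and> finite u \<and> card u \<le> k}"
    using bound k_pos by auto
  moreover have "\<Union>?T = B" by auto
  ultimately show ?thesis
    using assms unfolding spread_def P_le_def P_def hereditary_pair_def by blast
qed

lemma restr_spread:
  assumes "infinite B"
  shows "restr (spread S B) n = spread S (first_elems B n)"
proof -
  let ?F = "first_elems B n"
  have FB: "?F \<subseteq> B" using first_elems_subset assms .
  have "{u \<inter> ?F | u. u \<in> {u \<in> S. u \<subseteq> B} \<union> insert {} ((\<lambda>b. {b}) ` B)} =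
      {u \<in> S. u \<subseteq> ?F} \<union> insert {} ((\<lambda>b. {b}) ` ?F)" (is "?L = ?R")
  proof
    show "?L \<subseteq> ?R" using hered[OF Int_lower1[of _ ?F]] by auto
    show "?R \<subseteq> ?L"
    proof
      fix u assume "u \<in> ?R"
      then have "u \<in> {u \<in> S. u \<subseteq> B} \<union> insert {} ((\<lambda>b. {b}) ` B)" "u = u \<inter> ?F"
        using FB by auto
      then show "u \<in> ?L" by blast
    qed
  qed
  then show ?thesis by (simp add: restr_def spread_def)
qed

lemma spread_mono: "C \<subseteq> B \<Longrightarrow> hfam_le (spread S C) (spread S B)"
  by (auto simp: spread_def hfam_le_def)

text \<open>Continuity of \<open>spread S\<close>: a subset of \<open>B\<close> that agrees with
  \<open>B\<close> below \<open>enumerate B n\<close> has the same first \<open>n\<close> elements,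
  so its spread lies below that of \<open>B\<close> and shares its \<open>n\<close>-th
  approximation.\<close>

lemma ellentuck_open_pull:
  assumes U: "openin (P_topology k) U"
  shows "ellentuck_open (pull U)"
  unfolding ellentuck_open_def
proof
  fix B assume "B \<in> pull U"
  then have B: "infinite B" "spread S B \<in> U" by auto
  then obtain n where n: "nbhd k (restr (spread S B) n) (spread S B) \<subseteq> U"
    using openin_P_topologyD U by blast
  have "C \<in> pull U"
    if C: "C \<subseteq> B" "infinite C" "C \<inter> {..<enumerate B n} = B \<inter> {..<enumerate B n}" for C
  proof -
    have F: "first_elems B n = C \<inter> {..<enumerate B n}" using C B by (simp add: first_elems_eq_Int)
    have "first_elems C (card (first_elems B n)) = first_elems B n"
      unfolding F by (rule first_elems_unique[OF C(2)]) (auto simp: beyond_def)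
    then have "restr (spread S C) n = restr (spread S B) n"
      using B C by (simp add: card_first_elems restr_spread)
    then have "spread S C \<in> nbhd k (restr (spread S B) n) (spread S B)"
      using spread_in_P_le spread_mono C by (auto simp: Ramsey_nbhd_def)
    then show ?thesis using n C by blast
  qed
  then show "\<exists>m. \<forall>C\<subseteq>B. infinite C \<and> C \<inter> {..<m} = B \<inter> {..<m} \<longrightarrow> C \<in> pull U" by blast
qed

text \<open>Below a spread of \<open>S\<close>, points with a fixed approximation differ only in their vertex set, because
  beyond the approximation there are only singletons.\<close>

lemma nbhd_spread:
  assumes s: "finite s" "\<Union>S \<subseteq> s" and B: "B \<in> ellentuck s A"
  shows "nbhd k (spread S s) (spread S B) = spread S ` ellentuck s B"
proof
  show "spread S ` ellentuck s B \<subseteq> nbhd k (spread S s) (spread S B)"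
  proof
    fix E assume "E \<in> spread S ` ellentuck s B"
    then obtain C where E: "E = spread S C" and C: "C \<in> ellentuck s B" by blast
    have "infinite C" "C \<subseteq> B" using B C by (auto simp: ellentuck_def)
    moreover from this have "restr E (card s) = spread S s"
      using E ellentuck_initial[OF s(1) C] by (simp add: restr_spread)
    ultimately show "E \<in> nbhd k (spread S s) (spread S B)"
      using spread_in_P_le spread_mono E by (auto simp: Ramsey_nbhd_def)
  qed
  show "nbhd k (spread S s) (spread S B) \<subseteq> spread S ` ellentuck s B"
  proof
    fix E assume E: "E \<in> nbhd k (spread S s) (spread S B)"
    obtain C T where CT: "E = (C, T)" by (cases E)
    from E obtain m where E: "E \<in> P" "hfam_le E (spread S B)" "restr E m = spread S s"
      using P_le_subset_P by (auto simp: Ramsey_nbhd_def)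
    note T = in_P_D[OF E(1)[unfolded CT]]
    have inf: "infinite C" and un: "\<Union>T = C" and herT: "\<And>u v. u \<subseteq> v \<Longrightarrow> v \<in> T \<Longrightarrow> u \<in> T"
      by (fact T)+
    have le: "C \<subseteq> B" "T \<subseteq> {u \<in> S. u \<subseteq> B} \<union> insert {} ((\<lambda>b. {b}) ` B)"
      using E(2) by (auto simp: CT hfam_le_def spread_def)
    have F: "first_elems C m = s"
      and tr: "{u \<inter> first_elems C m | u. u \<in> T} = {u \<in> S. u \<subseteq> s} \<union> insert {} ((\<lambda>b. {b}) ` s)"
      using E(3) unfolding CT restr_def spread_def prod.case prod.inject
      by (rule conjunct1, rule conjunct2)
    have "C \<in> ellentuck s B"
      using inf le(1) F first_elems_subset[OF inf, of m] first_elems_beyond[OF inf, of m]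
      by (auto simp: ellentuck_def)
    moreover have "T = {u \<in> S. u \<subseteq> C} \<union> insert {} ((\<lambda>b. {b}) ` C)"
    proof
      show "T \<subseteq> {u \<in> S. u \<subseteq> C} \<union> insert {} ((\<lambda>b. {b}) ` C)" using le(2) un by fastforce
      have "{b} \<in> T" if "b \<in> C" for b using that un herT by blast
      moreover have "{} \<in> T" using inf un herT[of "{}"] by fastforce
      \<comment> \<open>A face of \<open>S\<close> lies in the stem \<open>s\<close>, where the
        approximation of \<open>E\<close> records it as the trace of a face of \<open>T\<close>.
        Heredity then puts it into \<open>T\<close>.\<close>
      moreover have "u \<in> T" if "u \<in> S" for u
      proof -
        have "u \<in> {u \<inter> first_elems C m | u. u \<in> T}" unfolding tr using that s(2) by blast
        then show ?thesis using herT by blast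
      qed
      ultimately show "{u \<in> S. u \<subseteq> C} \<union> insert {} ((\<lambda>b. {b}) ` C) \<subseteq> T" by blast
    qed
    ultimately show "E \<in> spread S ` ellentuck s B" by (auto simp: CT spread_def)
  qed
qed

text \<open>The complement \<open>U\<close> of the closure of \<open>N\<close> is open, so its
  pullback is decided below \<open>s\<close>. Were it avoided, a nonempty basic open set would lie
  in the closure of \<open>N\<close>, contradicting nowhere density. So it is accepted, and
  \<open>U\<close> misses \<open>N\<close>.\<close>

lemma nowhere_dense_null:
  assumes N: "nowhere_dense_in (P_topology k) N" and s: "finite s" "\<Union>S \<subseteq> s" and A: "infinite A"
  shows "\<exists>B\<subseteq>A. infinite B \<and> ellentuck s B \<inter> pull N = {}"
proof -
  define U where "U = topspace (P_topology k) - P_topology k closure_of N"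
  have "openin (P_topology k) U" unfolding U_def by (simp add: openin_diff)
  then obtain B where B: "infinite B" "B \<subseteq> A"
    and dich: "ellentuck s B \<subseteq> pull U \<or> ellentuck s B \<inter> pull U = {}"
    using ellentuck_open_Ramsey[OF ellentuck_open_pull s(1) A] by blast
  have NU: "N \<inter> U = {}"
    using N closure_of_subset[of N "P_topology k"] by (auto simp: U_def nowhere_dense_in_def)
  have "ellentuck s B \<inter> pull U \<noteq> {}"
  proof
    assume disj: "ellentuck s B \<inter> pull U = {}"
    \<comment> \<open>Adding the stem leaves \<open>ellentuck s B\<close> unchanged and makes
      \<open>spread S s\<close> an approximation of \<open>spread S B'\<close>.\<close>
    define B' where "B' = s \<union> (B \<inter> beyond s)"
    have B': "B' \<in> ellentuck s B" unfolding B'_def using join_in_ellentuck s(1) B(1) .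
    then have inf: "infinite B'" by (rule ellentuck_infinite)
    define W where "W = nbhd k (spread S s) (spread S B')"
    have W: "W = spread S ` ellentuck s B"
      unfolding W_def nbhd_spread[OF s B'] by (simp add: B'_def ellentuck_join)
    have "spread S s = restr (spread S B') (card s)"
      using ellentuck_initial[OF s(1) B'] inf by (simp add: restr_spread)
    then have openW: "openin (P_topology k) W"
      unfolding W_def using spread_in_P_le[OF inf] by (auto intro: openin_nbhd restr_in_AP_le)
    have "W \<inter> U = {}" unfolding W using disj ellentuck_infinite by blast
    then have "W \<subseteq> P_topology k closure_of N" using openin_subset[OF openW] unfolding U_def by blast
    then have "W \<subseteq> {}" using interior_of_maximal[OF _ openW] N unfolding nowhere_dense_in_def by metis
    then show False using B' by (auto simp: W)
  qed
  then have "ellentuck s B \<inter> pull N = {}" using dich NU by blast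
  then show ?thesis using B by blast
qed

lemma meager_null:
  assumes X: "meager_in (P_topology k) X" and s: "finite s" "\<Union>S \<subseteq> s" and A: "infinite A"
  shows "\<exists>B\<subseteq>A. infinite B \<and> ellentuck s B \<inter> pull X = {}"
proof -
  obtain F where F: "countable F" "\<forall>N\<in>F. nowhere_dense_in (P_topology k) N" "X = \<Union>F"
    using X unfolding meager_in_def by blast
  show ?thesis
  proof (cases "F = {}")
    case True
    then show ?thesis using F A by auto
  next
    case False
    define N where "N i = from_nat_into F i" for i
    have N: "range N = F" unfolding N_def using False F(1) by (rule range_from_nat_into)
    \<comment> \<open>The stem grows to \<open>t\<close> while \<open>S\<close> stays fixed;
      \<open>\<Union>S \<subseteq> t\<close> still holds.\<close>
    have null: "\<exists>B\<subseteq>A. infinite B \<and> ellentuck t B \<inter> pull (N i) = {}"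
      if "finite t" "s \<subseteq> t" "infinite A" for i t A
      using nowhere_dense_null[of "N i" t A] F(2) N that s(2) by blast
    have X_eq: "pull X = (\<Union>i. pull (N i))" unfolding F(3) N[symmetric] by blast
    show ?thesis
      unfolding X_eq by (rule ellentuck_null_Union[of s "\<lambda>i. pull (N i)", OF null s(1) A])
  qed
qed

text \<open>First shrink to avoid the meager symmetric difference with \<open>U\<close>, then decide
  \<open>U\<close>. On what remains \<open>X\<close> and \<open>U\<close> agree.\<close>

lemma Baire_Ramsey:
  assumes X: "Baire_property_in (P_topology k) X" and s: "finite s" "\<Union>S \<subseteq> s" and A: "infinite A"
  shows "\<exists>B\<subseteq>A. infinite B \<and> (ellentuck s B \<subseteq> pull X \<or> ellentuck s B \<inter> pull X = {})"
proof -
  obtain U where U: "openin (P_topology k) U" "meager_in (P_topology k) ((X - U) \<union> (U - X))"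
    using X unfolding Baire_property_in_def by blast
  obtain B where B: "B \<subseteq> A" "infinite B" "ellentuck s B \<inter> pull ((X - U) \<union> (U - X)) = {}"
    using meager_null[OF U(2) s A] by blast
  obtain C where C: "infinite C" "C \<subseteq> B" "ellentuck s C \<subseteq> pull U \<or> ellentuck s C \<inter> pull U = {}"
    using ellentuck_open_Ramsey[OF ellentuck_open_pull[OF U(1)] s(1) B(2)] by blast
  have "ellentuck s C \<inter> pull ((X - U) \<union> (U - X)) = {}"
    using B(3) ellentuck_mono[OF C(2)] by blast
  then have "ellentuck s C \<subseteq> pull X \<or> ellentuck s C \<inter> pull X = {}" using C(3) by blast
  then show ?thesis using B C by blast
qed

end

section \<open>Passing from arbitrary approximations to spreads, and closedness\<close>

lemma bounded_family_AP_le: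
  assumes "(x, S) \<in> AP_le k" "k > 0"
  shows "bounded_family k S" "finite x" "\<Union>S = x" "spread S x = (x, S)"
proof -
  have her: "\<And>u v. u \<subseteq> v \<Longrightarrow> v \<in> S \<Longrightarrow> u \<in> S" and un: "\<Union>S = x" and emp: "x = {} \<longrightarrow> S = {{}}"
    and fin: "finite x" and bd: "S \<subseteq> {u. u \<subseteq> x \<and> finite u \<and> card u \<le> k}"
    using assms(1) unfolding AP_le_def AP_def hereditary_pair_def
    by (simp_all, meson+)
  show "bounded_family k S" by unfold_locales (use assms(2) her bd in auto)
  show "finite x" "\<Union>S = x" by fact+
  \<comment> \<open>For empty \<open>x\<close> this is the explicit clause of
    \<open>hereditary_pair\<close>; otherwise heredity gives it from any face.\<close>
  have "{} \<in> S" using emp un her[of "{}"] by fastforce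
  moreover have "{b} \<in> S" if "b \<in> x" for b using that un her by blast
  ultimately have "{u \<in> S. u \<subseteq> x} \<union> insert {} ((\<lambda>b. {b}) ` x) = S" using bd by blast
  then show "spread S x = (x, S)" by (simp add: spread_def)
qed

text \<open>A point of the nonempty set \<open>nbhd k a A\<close> shows that the vertices and faces
  of \<open>a\<close> belong to \<open>A\<close>, and \<open>A\<close> contains all its singletons.
  So spreads of the faces of \<open>a\<close> over subsets of \<open>C\<close> that contain the stem
  lie below \<open>A\<close>. Quantifying over all \<open>B\<close> allows \<open>B\<close> to be
  chosen by the Ellentuck argument before \<open>E\<close>.\<close>

lemma nbhd_reduction:
  assumes a: "a \<in> AP_le k" and k: "k > 0" and A: "A \<in> P_le k" and ne: "nbhd k a A \<noteq> {}"
  obtains S s C where "bounded_family k S" "finite s" "\<Union>S \<subseteq> s" "infinite C"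
    "\<forall>B\<subseteq>C. infinite B \<longrightarrow> (\<exists>E \<in> nbhd k a A. nbhd k a E = spread S ` ellentuck s B)"
proof -
  obtain x S where ax: "a = (x, S)" by (cases a)
  obtain C T where AC: "A = (C, T)" by (cases A)
  note a' = bounded_family_AP_le[OF a[unfolded ax] k]
  interpret bounded_family k S by (rule a')
  have A': "(C, T) \<in> P" using A P_le_subset_P AC by auto
  note A'' = in_P_D[OF A']
  have inf: "infinite C" and un: "\<Union>T = C" and herT: "\<And>u v. u \<subseteq> v \<Longrightarrow> v \<in> T \<Longrightarrow> u \<in> T"
    by (fact A'')+
  obtain D n where D: "D \<in> P" "hfam_le D A" "restr D n = a"
    using ne P_le_subset_P unfolding Ramsey_nbhd_def by blast
  have xS: "x \<subseteq> C" "S \<subseteq> T"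
  proof -
    obtain D1 D2 where D12: "D = (D1, D2)" by (cases D)
    have D1: "infinite D1" using in_P_D(1) D(1) D12 by blast
    have le: "D1 \<subseteq> C" "D2 \<subseteq> T" using D(2) by (auto simp: D12 AC hfam_le_def)
    have eq: "first_elems D1 n = x" "{u \<inter> first_elems D1 n | u. u \<in> D2} = S"
      using D(3) unfolding D12 ax restr_def prod.case prod.inject by (rule conjunct1, rule conjunct2)
    show "x \<subseteq> C" unfolding eq(1)[symmetric] using le(1) first_elems_subset[OF D1] by blast
    show "S \<subseteq> T" unfolding eq(2)[symmetric] using le(2) herT[OF Int_lower1] by blast
  qed
  have "\<exists>E \<in> nbhd k a A. nbhd k a E = spread S ` ellentuck x B" if B: "B \<subseteq> C" "infinite B" for B
  proof
    define B' where "B' = x \<union> (B \<inter> beyond x)"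
    have B': "B' \<in> ellentuck x B" unfolding B'_def using join_in_ellentuck a'(2) B(2) .
    then have inf': "infinite B'" by (rule ellentuck_infinite)
    have "B' \<subseteq> C" using B xS by (auto simp: B'_def)
    show "nbhd k a (spread S B') = spread S ` ellentuck x B"
      using nbhd_spread[OF a'(2) _ B'] a'(3,4) by (simp add: ax B'_def ellentuck_join)
    have "{b} \<in> T" if "b \<in> C" for b using that un herT by blast
    moreover have "{} \<in> T" using inf un herT[of "{}"] by fastforce
    ultimately have "hfam_le (spread S B') A"
      using xS \<open>B' \<subseteq> C\<close> by (auto simp: AC hfam_le_def spread_def)
    moreover have "restr (spread S B') (card x) = a"
      using ellentuck_initial[OF a'(2) B'] inf' a'(4) by (simp add: restr_spread ax)
    ultimately show "spread S B' \<in> nbhd k a A"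
      using spread_in_P_le[OF inf'] by (auto simp: Ramsey_nbhd_def)
  qed
  then show thesis using that[of S x C] a' inf by auto
qed

text \<open>A point of \<open>P\<close> lies in \<open>P_le k\<close> exactly when all its
  approximations lie in \<open>AP_le k\<close>, since each finite face is contained in some
  approximation. So \<open>P_le k\<close> is the preimage of a product of closed sets.\<close>

lemma closedin_P_le: "closedin (approx_topology P AP restr) (P_le k)"
proof -
  let ?Q = "product_topology (\<lambda>_. discrete_topology AP) (UNIV :: nat set)"
  let ?V = "topspace ?Q - (\<Pi>\<^sub>E n\<in>UNIV. AP_le k)"
  have top: "topspace (approx_topology P AP restr) = P"
    unfolding approx_topology_def topspace_pullback_topology by (auto simp: restr_in_AP)
  have sub: "AP_le k \<subseteq> AP" by (auto simp: AP_le_def)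
  have char: "X \<in> P_le k" if X: "X \<in> P" and r: "\<And>n. restr X n \<in> AP_le k" for X
  proof -
    obtain A S where XA: "X = (A, S)" by (cases X)
    note X' = in_P_D[OF X[unfolded XA]]
    have inf: "infinite A" and S: "S \<subseteq> {u. u \<subseteq> A \<and> finite u}" by (fact X')+
    have "card u \<le> k" if u: "u \<in> S" for u
    proof -
      obtain m where m: "u \<subseteq> {..<m}" using u S finite_nat_iff_bounded by blast
      \<comment> \<open>Because \<open>m \<le> enumerate A m\<close>, the first \<open>m\<close>
        elements of \<open>A\<close> include every element below \<open>m\<close>.\<close>
      have "u \<subseteq> first_elems A m"
        unfolding first_elems_eq_Int[OF inf] using m u S le_enumerate[OF inf, of m] by fastforce
      then have "u \<in> snd (restr X m)" using u by (auto simp: XA restr_def)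
      then show ?thesis using r[of m] by (auto simp: AP_le_def)
    qed
    then show ?thesis using X S unfolding P_le_def XA by auto
  qed
  have "closedin ?Q (\<Pi>\<^sub>E n\<in>UNIV. AP_le k)"
    unfolding closedin_product_topology using sub by simp
  then have "openin ?Q ?V" by (rule openin_diff[OF openin_topspace])
  moreover have "P - P_le k = (\<lambda>A n. restr A n) -` ?V \<inter> P"
  proof (rule set_eqI)
    fix X
    have V: "f \<in> ?V \<longleftrightarrow> (\<forall>n. f n \<in> AP) \<and> \<not> (\<forall>n. f n \<in> AP_le k)" for f
      by (auto simp: PiE_UNIV_domain Pi_iff)
    show "X \<in> P - P_le k \<longleftrightarrow> X \<in> (\<lambda>A n. restr A n) -` ?V \<inter> P"
      unfolding Int_iff vimage_eq V using char restr_in_AP restr_in_AP_le by blast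
  qed
  ultimately have "openin (approx_topology P AP restr) (P - P_le k)"
    unfolding approx_topology_def openin_pullback_topology by blast
  then show ?thesis unfolding closedin_def top using P_le_subset_P by simp
qed

theorem theorem6p1p1:
  fixes k :: nat
  assumes "k > 0"
  shows "topological_Ramsey_space (P_le k) (AP_le k) hfam_le restr \<and>
    closedin (approx_topology P AP restr) (P_le k)"
proof
  show "closedin (approx_topology P AP restr) (P_le k)" by (rule closedin_P_le)
  show "topological_Ramsey_space (P_le k) (AP_le k) hfam_le restr"
    unfolding topological_Ramsey_space_def
  proof (intro conjI allI impI)
    fix X assume X: "Baire_property_in (P_topology k) X"
    show "is_Ramsey (P_le k) (AP_le k) hfam_le restr X"
      unfolding is_Ramsey_def
    proof (intro ballI impI)
      fix a A assume aA: "a \<in> AP_le k" "A \<in> P_le k" "nbhd k a A \<noteq> {}"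
      obtain S s C where
        S: "bounded_family k S" and s: "finite s" "\<Union>S \<subseteq> s" and C: "infinite C"
        and red: "\<forall>B\<subseteq>C. infinite B \<longrightarrow>
          (\<exists>E \<in> nbhd k a A. nbhd k a E = spread S ` ellentuck s B)"
        by (rule nbhd_reduction[OF aA(1) assms aA(2,3)])
      from bounded_family.Baire_Ramsey[OF S X s C] obtain B where B: "B \<subseteq> C" "infinite B"
        and dich: "ellentuck s B \<subseteq> {B. infinite B \<and> spread S B \<in> X} \<or>
          ellentuck s B \<inter> {B. infinite B \<and> spread S B \<in> X} = {}" by blast
      obtain E where E: "E \<in> nbhd k a A" "nbhd k a E = spread S ` ellentuck s B"
        using red B by blast
      \<comment> \<open>Each point of \<open>nbhd k a E\<close> is the spread of a set in
        \<open>ellentuck s B\<close>, so the dichotomy for the pullback of \<open>X\<close> carries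
        over to \<open>X\<close>.\<close>
      have "nbhd k a E \<subseteq> X \<or> nbhd k a E \<inter> X = {}"
        unfolding E(2) using dich ellentuck_infinite by blast
      then show "\<exists>E \<in> nbhd k a A. nbhd k a E \<subseteq> X \<or> nbhd k a E \<inter> X = {}" using E(1) by blast
    qed
  next
    fix X assume X: "meager_in (P_topology k) X"
    show "is_Ramsey_null (P_le k) (AP_le k) hfam_le restr X"
      unfolding is_Ramsey_null_def
    proof (intro ballI impI)
      fix a A assume aA: "a \<in> AP_le k" "A \<in> P_le k" "nbhd k a A \<noteq> {}"
      obtain S s C where
        S: "bounded_family k S" and s: "finite s" "\<Union>S \<subseteq> s" and C: "infinite C"
        and red: "\<forall>B\<subseteq>C. infinite B \<longrightarrow>
          (\<exists>E \<in> nbhd k a A. nbhd k a E = spread S ` ellentuck s B)"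
        by (rule nbhd_reduction[OF aA(1) assms aA(2,3)])
      from bounded_family.meager_null[OF S X s C] obtain B where B: "B \<subseteq> C" "infinite B"
        and null: "ellentuck s B \<inter> {B. infinite B \<and> spread S B \<in> X} = {}" by blast
      obtain E where E: "E \<in> nbhd k a A" "nbhd k a E = spread S ` ellentuck s B"
        using red B by blast
      have "nbhd k a E \<inter> X = {}" unfolding E(2) using null ellentuck_infinite by blast
      then show "\<exists>E \<in> nbhd k a A. nbhd k a E \<inter> X = {}" using E(1) by blast
    qed
  qed
qed

end
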